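(* Every graph in $\varepsilon_0$ has at least one vertex of degree $2$.
   Context: All graphs are finite, simple, undirected and connected. An Euler graph is a connected graph in which every vertex has even degree. $\varepsilon_0$ denotes the class of Euler graphs $G$ such that every cycle of $G$ has length $n\equiv 0 \pmod 4$.
   Formalization: The graph is assumed to have at least two vertices: the one-vertex graph is connected, has only even degrees and no cycles, so it lies in ε₀ but has no vertex of degree 2; only this graph is excluded. *)

theory Defs
  imports "Graph_Theory.Digraph_Component"
begin

text \<open>
  The locale \<^locale>\<open>graph\<close> represents finite simple undirected graphs as symmetric digraphs:
  an edge is a pair of opposite arcs, so \<^const>\<open>out_degree\<close> is the degree of a vertex.
  \<^const>\<open>connected\<close> excludes the null graph.
\<close>

definition euler_graph :: "('a, 'b) pre_digraph \<Rightarrow> bool" where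
  "euler_graph G \<longleftrightarrow> graph G \<and> connected G \<and> (\<forall>v \<in> verts G. even (out_degree G v))"

text \<open>
  In a symmetric digraph, \<^const>\<open>pre_digraph.cycle\<close> also accepts going back and forth along one
  edge. In a simple graph these are the only cycles of length below 3, so the length bound
  leaves exactly the undirected cycles.
\<close>

definition undirected_cycle :: "('a, 'b) pre_digraph \<Rightarrow> 'b awalk \<Rightarrow> bool" where
  "undirected_cycle G p \<longleftrightarrow> pre_digraph.cycle G p \<and> 3 \<le> length p"

text \<open>
  As defined, the class contains the one-vertex graph, whose only vertex has degree 0.
\<close>

definition \<epsilon>\<^sub>0 :: "('a, 'b) pre_digraph set" where
  "\<epsilon>\<^sub>0 = {G. euler_graph G \<and> (\<forall>p. undirected_cycle G p \<longrightarrow> length p mod 4 = 0)}"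

end

theory Submission
  imports Defs
begin

text \<open>
  Suppose that every degree is at least 3, and let \<open>u\<close> be the first vertex of a longest path.
  All neighbours of \<open>u\<close> lie on the path, so two of them have positions \<open>2 \<le> i < j\<close>
  (the position of \<open>u\<close> being 0). The path segments between \<open>u\<close> and these neighbours close to
  cycles of length \<open>i + 1\<close>, \<open>j + 1\<close> and \<open>j - i + 2\<close>, which cannot all be divisible by 4.
\<close>

text \<open>A path repeats no vertex, so \<open>card (verts G)\<close> bounds all lengths. The
  maximum is over all pairs of endpoints, so that a path extended at its start still
  competes.\<close>

lemma (in fin_digraph) ex_maximal_apath:
  assumes "verts G \<noteq> {}"
  obtains u p v where "apath u p v"
    and "\<And>u' p' v'. apath u' p' v' \<Longrightarrow> length p' \<le> length p"
proof -
  let ?P = "\<lambda>n. \<exists>u p v. apath u p v \<and> length p = n"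
  obtain x where "x \<in> verts G" using assms by blast
  then have "apath x [] x" by (simp add: apath_Nil_iff)
  then have "?P 0" by force
  moreover have "\<forall>n. ?P n \<longrightarrow> n \<le> card (verts G)" using length_apath by blast
  ultimately have "?P (Greatest ?P)" and "\<forall>n. ?P n \<longrightarrow> n \<le> Greatest ?P"
    using GreatestI_nat[of ?P 0 "card (verts G)"] Greatest_le_nat[of ?P _ "card (verts G)"]
    by blast+
  then show ?thesis using that by metis
qed

lemma (in graph) reverse_arc:
  assumes "e \<in> arcs G"
  obtains e' where "e' \<in> arcs G" "tail G e' = head G e" "head G e' = tail G e"
  using assms sym_arcs unfolding symmetric_conv by metis

text \<open>With the closing arc put first, the vertices of \<open>e # p\<close> after the initial
  \<open>v\<close> are those of \<open>p\<close>, which are distinct. The bound on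
  \<open>length p\<close> rules out going back and forth along one edge.\<close>

lemma (in graph) undirected_cycle_closed_apath:
  assumes "apath u p v" "2 \<le> length p" "e \<in> arcs G" "tail G e = v" "head G e = u"
  shows "undirected_cycle G (e # p)"
  using assms unfolding undirected_cycle_def cycle_def apath_def
  by (auto simp: awalk_Cons_iff intro!: exI[of _ v])

text \<open>Otherwise the reverse of \<open>e\<close>, put in front of \<open>p\<close>, would give
  a longer path.\<close>

lemma (in graph) head_in_maximal_apath:
  assumes "apath u p v"
    and "\<And>u' p' v'. apath u' p' v' \<Longrightarrow> length p' \<le> length p"
    and "e \<in> out_arcs G u"
  shows "head G e \<in> set (awalk_verts u p)"
proof (rule ccontr)
  assume "head G e \<notin> set (awalk_verts u p)"
  moreover obtain e' where "e' \<in> arcs G" "tail G e' = head G e" "head G e' = u"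
    using assms(3) reverse_arc by force
  ultimately have "apath (head G e) (e' # p) v"
    using assms(1) by (simp add: apath_Cons_iff)
  from assms(2)[OF this] show False by simp
qed

lemma (in graph) ex_cycle_length_not_dvd_4:
  assumes "verts G \<noteq> {}" and deg: "\<And>v. v \<in> verts G \<Longrightarrow> 3 \<le> out_degree G v"
  shows "\<exists>c. undirected_cycle G c \<and> length c mod 4 \<noteq> 0"
proof (rule ccontr)
  assume "\<not> ?thesis"
  then have mod4: "length c mod 4 = 0" if "undirected_cycle G c" for c
    using that by blast
  obtain u p v where p: "apath u p v"
    and max: "\<And>u' p' v'. apath u' p' v' \<Longrightarrow> length p' \<le> length p"
    using ex_maximal_apath[OF assms(1)] by blast
  define A where "A = out_arcs G u"
  have u: "u \<in> verts G" using p by (auto simp: apath_def)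
  \<comment> \<open>The position of a neighbour is the length of the prefix of \<open>p\<close> that
    ends there.\<close>
  have "\<exists>i. i \<le> length p \<and> apath u (take i p) (head G e)" if e: "e \<in> A" for e
  proof -
    have "head G e \<in> set (awalk_verts u p)"
      using p max e unfolding A_def by (rule head_in_maximal_apath)
    then obtain q r where qr: "p = q @ r" "awalk u q (head G e)"
      using awalk_decomp[OF awalkI_apath[OF p]] by blast
    then have "apath u q (head G e)"
      using p by (auto simp: apath_append_iff)
    with qr show ?thesis by (intro exI[of _ "length q"]) simp
  qed
  then obtain f where f: "\<And>e. e \<in> A \<Longrightarrow> f e \<le> length p"
    and path: "\<And>e. e \<in> A \<Longrightarrow> apath u (take (f e) p) (head G e)"
    by metis
  \<comment> \<open>Equal positions mean equal neighbours, and without parallel arcs the neighbour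
    determines the arc.\<close>
  have "inj_on f A"
  proof (rule inj_onI)
    fix e1 e2 assume e: "e1 \<in> A" "e2 \<in> A" "f e1 = f e2"
    then have "head G e1 = head G e2"
      using path[of e1] path[of e2] by (metis apath_ends)
    then show "e1 = e2"
      using e by (intro no_multi_arcs) (auto simp: A_def arc_to_ends_def)
  qed
  have pos: "f e \<noteq> 0" if "e \<in> A" for e
    using path[OF that] that no_loops[of e] by (auto simp: apath_Nil_iff A_def intro: Nat.gr0I)
  \<comment> \<open>Position 1 would close up to a mere back and forth walk. Dropping it leaves at
    least two of the three or more positions.\<close>
  have "card (f ` A - {1}) \<ge> card (f ` A) - card {1::nat}"
    by (rule diff_card_le_card_Diff) simp
  then have "\<not> card (f ` A - {1}) \<le> Suc 0"
    using deg[OF u] card_image[OF \<open>inj_on f A\<close>] by (simp add: out_degree_def A_def)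
  moreover have "finite (f ` A - {1})" by (simp add: A_def finite_out_arcs)
  ultimately obtain k l where "k \<in> f ` A - {1}" "l \<in> f ` A - {1}" "k \<noteq> l"
    using card_le_Suc0_iff_eq by blast
  then obtain e1 e2 where e: "e1 \<in> A" "e2 \<in> A" "f e1 < f e2" "f e1 \<noteq> 1"
    by (cases k l rule: linorder_cases) auto
  have two: "2 \<le> f e1" using pos[OF e(1)] e(4) by linarith
  have rev_arc: "\<exists>a \<in> arcs G. tail G a = head G e \<and> head G a = u" if "e \<in> A" for e
    using that reverse_arc[of e] by (auto simp: A_def)
  have cycle: "(f e + 1) mod 4 = 0" if ea: "e \<in> A" "2 \<le> f e" for e
  proof -
    obtain a where "a \<in> arcs G" "tail G a = head G e" "head G a = u"
      using rev_arc ea by blast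
    then have "undirected_cycle G (a # take (f e) p)"
      using undirected_cycle_closed_apath[OF path] ea f by simp
    from mod4[OF this] show ?thesis using f[OF ea(1)] by simp
  qed
  define q where "q = take (f e2 - f e1) (drop (f e1) p)"
  have split: "take (f e2) p = take (f e1) p @ q"
    using e(3) take_add[of "f e1" "f e2 - f e1" p] by (simp add: q_def)
  have len: "length q = f e2 - f e1" using f[OF e(2)] by (simp add: q_def)
  have awl: "awlast u (take (f e1) p) = head G e1"
    using path[OF e(1)] by (auto simp: apath_def)
  have q: "apath (head G e1) q (head G e2)"
    using path[OF e(2)] unfolding split by (auto simp: apath_append_iff awl)
  \<comment> \<open>The simple path \<open>p\<close> starts at \<open>u\<close> and meets
    \<open>q\<close> only later, so the arc \<open>e1\<close> can be put in front of
    \<open>q\<close>.\<close>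
  have "u \<notin> set (awalk_verts (head G e1) q)"
  proof -
    have "u \<noteq> head G e1" using no_loops e(1) by (auto simp: A_def)
    moreover have "u \<notin> set (tl (awalk_verts (head G e1) q))"
      using path[OF e(2)] hd_in_awalk_verts(2)[OF path[OF e(1)]]
      unfolding split by (auto simp: apath_append_iff awl)
    moreover have "hd (awalk_verts (head G e1) q) = head G e1"
      using q by (auto simp: apath_def)
    ultimately show ?thesis
      by (metis awalk_verts_non_Nil list.collapse set_ConsD)
  qed
  then have chord: "apath u (e1 # q) (head G e2)"
    using q e(1) by (simp add: apath_Cons_iff A_def)
  obtain a where "a \<in> arcs G" "tail G a = head G e2" "head G a = u"
    using rev_arc e(2) by blast
  then have "undirected_cycle G (a # e1 # q)"
    using undirected_cycle_closed_apath[OF chord] len e(3) by simp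
  from mod4[OF this] have "(f e2 - f e1 + 2) mod 4 = 0" using len by simp
  moreover have "(f e1 + 1) mod 4 = 0" "(f e2 + 1) mod 4 = 0"
    using cycle e two by simp_all
  \<comment> \<open>Both positions are 3 modulo 4, so their difference plus 2 is 2 modulo 4.\<close>
  ultimately show False using e(3) by presburger
qed

text \<open>A walk to a second vertex must leave \<open>v\<close> by some arc. This excludes degree
  0, which evenness permits.\<close>

lemma (in graph) connected_imp_out_degree_pos:
  assumes "connected G" "2 \<le> card (verts G)" "v \<in> verts G"
  shows "0 < out_degree G v"
proof -
  have "\<not> card (verts G) \<le> Suc 0" using assms(2) by simp
  then obtain w where w: "w \<in> verts G" "w \<noteq> v"
    using card_le_Suc0_iff_eq[OF finite_verts] by metis
  have "v \<rightarrow>\<^sup>* w"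
    using symmetric_connected_imp_strongly_connected[OF sym_arcs assms(1)] assms(3) w(1)
    by auto
  then obtain x where "v \<rightarrow> x"
    using w(2) by (cases rule: converse_reachable_cases) auto
  then have "out_arcs G v \<noteq> {}" by (auto simp: arcs_ends_conv)
  then show ?thesis by (simp add: out_degree_def card_gt_0_iff finite_out_arcs)
qed

theorem theorem4:
  fixes G :: "('a, 'b) pre_digraph"
  assumes "G \<in> \<epsilon>\<^sub>0"
    and nontrivial: "card (verts G) \<ge> 2"
  shows "\<exists>v \<in> verts G. out_degree G v = 2"
proof (rule ccontr)
  assume no2: "\<not> ?thesis"
  have "graph G" and conn: "connected G"
    and even: "\<And>v. v \<in> verts G \<Longrightarrow> even (out_degree G v)"
    and mod4: "\<And>c. undirected_cycle G c \<Longrightarrow> length c mod 4 = 0"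
    using assms(1) by (auto simp: \<epsilon>\<^sub>0_def euler_graph_def)
  interpret graph G by fact
  have "3 \<le> out_degree G v" if v: "v \<in> verts G" for v
  proof -
    have "out_degree G v \<noteq> 2" using no2 v by blast
    then show ?thesis
      using connected_imp_out_degree_pos[OF conn nontrivial v] even[OF v] by presburger
  qed
  moreover have "verts G \<noteq> {}" using nontrivial by auto
  ultimately show False using ex_cycle_length_not_dvd_4 mod4 by metis
qed

end
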